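(* (a) For any $(v,k,\lambda)$-BIBD, there is at most one positive integer $\ell$ such that the BIBD admits a $0$-ULSE $\ell$-colouring with $\ell<v$. (b) If $\mathcal{D}_1$ is a $(v,k,\lambda_1)$-BIBD admitting a $0$-ULSE $\ell_1$-colouring with $\ell_1<v$ and $\mathcal{D}_2$ is a $(v,k,\lambda_2)$-BIBD admitting a $0$-ULSE $\ell_2$-colouring with $\ell_2<v$, then $\ell_1=\ell_2$.
   Context: For positive integers $v,k,\lambda$ with $2\le k<v$, a $(v,k,\lambda)$-BIBD is a pair $(V,\mathcal{B})$ where $V$ is a set of $v$ points and $\mathcal{B}$ is a collection of $k$-element subsets of $V$ (blocks) such that every pair of distinct points lies in exactly $\lambda$ blocks. An $\ell$-colouring is a surjective map from $V$ onto a set of $\ell$ colours. A $0$-ULSE $\ell$-colouring is an $\ell$-colouring such that $(\ell-1)$ divides $k$ and in every block exactly one colour does not appear, while each of the other $\ell-1$ colours appears exactly $\frac{k}{\ell-1}$ times in that block. It is nontrivial if $\ell<v$. *)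

theory Defs
  imports Main "HOL-Library.Multiset"
begin

text \<open>The blocks form a multiset, since a block design may have repeated blocks.\<close>

definition bibd :: "'a set \<Rightarrow> 'a set multiset \<Rightarrow> nat \<Rightarrow> nat \<Rightarrow> nat \<Rightarrow> bool" where
  "bibd V \<B> v k lam \<longleftrightarrow>
     0 < lam \<and> 2 \<le> k \<and> k < v \<and>
     finite V \<and> card V = v \<and>
     (\<forall>B \<in># \<B>. B \<subseteq> V \<and> card B = k) \<and>
     (\<forall>x \<in> V. \<forall>y \<in> V. x \<noteq> y \<longrightarrow> size {#B \<in># \<B>. x \<in> B \<and> y \<in> B#} = lam)"

definition colouring :: "'a set \<Rightarrow> nat \<Rightarrow> 'c set \<Rightarrow> ('a \<Rightarrow> 'c) \<Rightarrow> bool" where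
  "colouring V l C f \<longleftrightarrow> finite C \<and> card C = l \<and> f ` V = C"

text \<open>The conjunct \<open>0 < l\<close> keeps the subtraction \<open>l - 1\<close> from truncating.\<close>

definition zero_ulse_colouring ::
    "'a set \<Rightarrow> 'a set multiset \<Rightarrow> nat \<Rightarrow> nat \<Rightarrow> 'c set \<Rightarrow> ('a \<Rightarrow> 'c) \<Rightarrow> bool" where
  "zero_ulse_colouring V \<B> k l C f \<longleftrightarrow>
     0 < l \<and> colouring V l C f \<and> (l - 1) dvd k \<and>
     (\<forall>B \<in># \<B>.
        (\<exists>!c. c \<in> C \<and> c \<notin> f ` B) \<and>
        (\<forall>c \<in> C. c \<in> f ` B \<longrightarrow> card {x \<in> B. f x = c} = k div (l - 1)))"

text \<open>Colour sets are finite, so taking the colours to be natural numbers loses no generality.\<close>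

definition admits_zero_ulse :: "'a set \<Rightarrow> 'a set multiset \<Rightarrow> nat \<Rightarrow> nat \<Rightarrow> bool" where
  "admits_zero_ulse V \<B> k l \<longleftrightarrow>
     (\<exists>(C :: nat set) f. zero_ulse_colouring V \<B> k l C f)"

end

theory Submission
  imports Defs
begin

text \<open>Fix a point \<open>x\<close> lying in \<open>r\<close> blocks, let \<open>s\<close> be the size of its colour class and
  \<open>m = k / (l - 1)\<close>. Counting the pairs \<open>(y, B)\<close> with \<open>x, y \<in> B\<close> and \<open>y \<noteq> x\<close>, once over all
  \<open>y\<close> and once over the \<open>y\<close> of the colour of \<open>x\<close>, gives \<open>\<lambda> (v - 1) = r (k - 1)\<close> and
  \<open>\<lambda> (s - 1) = r (m - 1)\<close>, so \<open>(s - 1) (k - 1) = (m - 1) (v - 1)\<close>. Hence all classes have the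
  same size \<open>s = v / l\<close>, and substituting turns this into \<open>(l - 1)\<^sup>2 (v - k) = k (v - 1)\<close>, which
  determines \<open>l\<close> from \<open>v\<close> and \<open>k\<close>.\<close>

text \<open>Double counting: both sides count the pairs \<open>(x, B)\<close> with
  \<open>P x B\<close>, repeated blocks being counted with multiplicity.\<close>

lemma sum_size_filter_mset_eq:
  assumes "finite S"
  shows "(\<Sum>x\<in>S. size {#B \<in># M. P x B#}) = (\<Sum>B\<in>#M. card {x \<in> S. P x B})"
proof (induction M)
  case (add B M)
  have "(\<Sum>x\<in>S. size {#B' \<in># add_mset B M. P x B'#})
      = (\<Sum>x\<in>S. of_bool (P x B) + size {#B' \<in># M. P x B'#})"
    by (intro sum.cong) auto
  also have "\<dots> = card {x \<in> S. P x B} + (\<Sum>x\<in>S. size {#B' \<in># M. P x B'#})"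
    using assms by (simp add: sum.distrib Collect_conj_eq)
  finally show ?case using add.IH by simp
qed simp

text \<open>Used with \<open>S = V\<close> and with \<open>S\<close> a colour class. Constant
  intersection is asked only of blocks through \<open>x\<close>, since a block that omits a colour
  misses its whole class.\<close>

lemma bibd_count_through_point:
  assumes "bibd V \<B> v k lam" "S \<subseteq> V" "x \<in> S"
    and blocks: "\<And>B. B \<in># \<B> \<Longrightarrow> x \<in> B \<Longrightarrow> card (S \<inter> B) = m"
  shows "(card S - 1) * lam = size {#B \<in># \<B>. x \<in> B#} * (m - 1)"
proof -
  have fin: "finite S" using assms by (auto simp: bibd_def intro: finite_subset)
  have "(card S - 1) * lam = (\<Sum>y\<in>S - {x}. size {#B \<in># \<B>. x \<in> B \<and> y \<in> B#})"
  proof -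
    have "size {#B \<in># \<B>. x \<in> B \<and> y \<in> B#} = lam" if "y \<in> S - {x}" for y
    proof -
      have "x \<in> V" "y \<in> V" "x \<noteq> y" using that assms(2,3) by auto
      with assms(1) show ?thesis unfolding bibd_def by blast
    qed
    then show ?thesis using fin assms(3) by simp
  qed
  also have "\<dots> = (\<Sum>B\<in>#\<B>. card {y \<in> S - {x}. x \<in> B \<and> y \<in> B})"
    using fin by (intro sum_size_filter_mset_eq) simp
  also have "\<dots> = (\<Sum>B\<in>#\<B>. if x \<in> B then m - 1 else 0)"
  proof -
    have "card {y \<in> S - {x}. x \<in> B \<and> y \<in> B} = (if x \<in> B then m - 1 else 0)" if "B \<in># \<B>" for B
    proof (cases "x \<in> B")
      case True
      then have "{y \<in> S - {x}. x \<in> B \<and> y \<in> B} = (S \<inter> B) - {x}" by auto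
      with True show ?thesis using blocks[OF that True] assms(3) fin by simp
    qed simp
    then show ?thesis by (intro arg_cong[where f = sum_mset] image_mset_cong)
  qed
  also have "\<dots> = size {#B \<in># \<B>. x \<in> B#} * (m - 1)"
    by (induction \<B>) auto
  finally show ?thesis .
qed

lemma zero_ulse_colour_class:
  assumes bibd: "bibd V \<B> v k lam" and ulse: "zero_ulse_colouring V \<B> k l C f" and "x \<in> V"
  shows "(card {y \<in> V. f y = f x} - 1) * (k - 1) = (k div (l - 1) - 1) * (v - 1)"
proof -
  define r where "r = size {#B \<in># \<B>. x \<in> B#}"
  have V: "card V = v" "lam > 0" "2 \<le> k" "k < v"
    and block: "\<And>B. B \<in># \<B> \<Longrightarrow> B \<subseteq> V \<and> card B = k"
    using bibd by (auto simp: bibd_def)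
  have "(card V - 1) * lam = r * (k - 1)"
    unfolding r_def using bibd \<open>x \<in> V\<close> block
    by (intro bibd_count_through_point) (auto simp: Int_absorb1)
  then have all: "(v - 1) * lam = r * (k - 1)" using V by simp
  then have "r > 0" using V by (cases "r = 0") auto
  \<comment> \<open>A block through \<open>x\<close> contains the colour of \<open>x\<close>, so
    that colour is not the missing one and appears \<open>k div (l - 1)\<close> times.\<close>
  have "card ({y \<in> V. f y = f x} \<inter> B) = k div (l - 1)" if "B \<in># \<B>" "x \<in> B" for B
  proof -
    have "{y \<in> V. f y = f x} \<inter> B = {y \<in> B. f y = f x}" using block[OF that(1)] by auto
    moreover have "f x \<in> C" "f x \<in> f ` B"
      using ulse \<open>x \<in> V\<close> that by (auto simp: zero_ulse_colouring_def colouring_def)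
    ultimately show ?thesis using ulse that by (simp add: zero_ulse_colouring_def)
  qed
  then have col_class: "(card {y \<in> V. f y = f x} - 1) * lam = r * (k div (l - 1) - 1)"
    unfolding r_def using bibd \<open>x \<in> V\<close> by (intro bibd_count_through_point) auto
  \<comment> \<open>Multiplying the two counts crosswise lets the positive factor
    \<open>r * lam\<close> cancel, with no division.\<close>
  have "(r * lam) * ((card {y \<in> V. f y = f x} - 1) * (k - 1))
      = ((card {y \<in> V. f y = f x} - 1) * lam) * (r * (k - 1))"
    by simp
  also have "\<dots> = (r * (k div (l - 1) - 1)) * ((v - 1) * lam)"
    by (simp only: col_class all)
  also have "\<dots> = (r * lam) * ((k div (l - 1) - 1) * (v - 1))"
    by simp
  finally show ?thesis using \<open>r > 0\<close> V by simp
qed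

lemma zero_ulse_equation:
  assumes bibd: "bibd V \<B> v k lam" and "admits_zero_ulse V \<B> k l"
  shows "(l - 1)\<^sup>2 * (v - k) = k * (v - 1)" and "0 < l"
proof -
  obtain C :: "nat set" and f where ulse: "zero_ulse_colouring V \<B> k l C f"
    using assms(2) by (auto simp: admits_zero_ulse_def)
  show "0 < l" using ulse by (simp add: zero_ulse_colouring_def)
  have V: "finite V" "card V = v" "2 \<le> k" "k < v"
    using bibd by (auto simp: bibd_def)
  have C: "finite C" "card C = l" "f ` V = C"
    using ulse by (auto simp: zero_ulse_colouring_def colouring_def)
  define m where "m = k div (l - 1)"
  \<comment> \<open>The class size solved from the relation of the previous lemma; the formula does
    not mention the colour. The division is exact, and the final 1 restores the class size because
    every class is nonempty.\<close>
  define s where "s = (m - 1) * (v - 1) div (k - 1) + 1"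
  have k: "k = (l - 1) * m" using ulse by (simp add: m_def zero_ulse_colouring_def)
  have m_pos: "1 \<le> m" using k V by (cases m) auto
  have col_class: "card {y \<in> V. f y = c} = s \<and> (s - 1) * (k - 1) = (m - 1) * (v - 1)"
    if "c \<in> C" for c
  proof -
    obtain x where x: "x \<in> V" "f x = c" using \<open>c \<in> C\<close> C(3) by blast
    have eq: "(card {y \<in> V. f y = c} - 1) * (k - 1) = (m - 1) * (v - 1)"
      using zero_ulse_colour_class[OF bibd ulse x(1)] x by (simp add: m_def)
    then have "(m - 1) * (v - 1) div (k - 1) = card {y \<in> V. f y = c} - 1"
      using V nonzero_mult_div_cancel_right[of "k - 1" "card {y \<in> V. f y = c} - 1"] by simp
    moreover have "card {y \<in> V. f y = c} > 0" using x V by (auto simp: card_gt_0_iff)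
    ultimately have "card {y \<in> V. f y = c} = s" unfolding s_def by linarith
    with eq show ?thesis by simp
  qed
  have v: "v = l * s"
  proof -
    have "card V = (\<Sum>c\<in>C. card {y \<in> V. f y = c})"
      using V C sum.group[of V C f "\<lambda>_. 1 :: nat"] by simp
    also have "\<dots> = l * s" using col_class C by simp
    finally show ?thesis using V by simp
  qed
  obtain c where "c \<in> C" using C \<open>0 < l\<close> by fastforce
  then have eq: "(s - 1) * (k - 1) = (m - 1) * (v - 1)" using col_class by blast
  have pos: "s \<ge> 1" "m \<ge> 1" "k \<ge> 1" "v \<ge> 1" "l \<ge> 1" "k \<le> v"
    using V m_pos \<open>0 < l\<close> by (simp_all add: s_def)
  \<comment> \<open>Over the integers the differences can be expanded freely; the bounds in
    \<open>pos\<close> make each truncated subtraction exact.\<close>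
  have eqi: "(int s - 1) * (int k - 1) = (int m - 1) * (int v - 1)"
    using arg_cong[OF eq, of int] pos by simp
  have ki: "int k = (int l - 1) * int m"
    using arg_cong[OF k, of int] pos by simp
  have vi: "int v = int l * int s" using v by simp
  \<comment> \<open>A polynomial identity in \<open>v\<close>, \<open>k\<close> and
    \<open>l\<close>. Substituting \<open>v = l * s\<close> and \<open>k = (l - 1) * m\<close> turns
    its right side into a multiple of the difference of the two sides of \<open>eqi\<close>.\<close>
  have "(int l - 1)\<^sup>2 * (int v - int k) - int k * (int v - 1)
      = (int v - int l) * (int l - 1) * (int k - 1) - (int k - (int l - 1)) * (int v - 1) * int l"
    by (simp add: algebra_simps power2_eq_square)
  also have "int v - int l = int l * (int s - 1)"
    by (simp add: vi right_diff_distrib)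
  also have "int k - (int l - 1) = (int l - 1) * (int m - 1)"
    by (simp add: ki right_diff_distrib)
  also have "int l * (int s - 1) * (int l - 1) * (int k - 1)
        - (int l - 1) * (int m - 1) * (int v - 1) * int l
      = int l * (int l - 1) * ((int s - 1) * (int k - 1) - (int m - 1) * (int v - 1))"
    by (simp only: right_diff_distrib mult_ac)
  also have "\<dots> = 0" using eqi by simp
  finally have "(int l - 1)\<^sup>2 * (int v - int k) = int k * (int v - 1)" by simp
  then have "int ((l - 1)\<^sup>2 * (v - k)) = int (k * (v - 1))"
    using pos by simp
  then show "(l - 1)\<^sup>2 * (v - k) = k * (v - 1)"
    by (simp only: of_nat_eq_iff)
qed

lemma zero_ulse_colours_unique:
  assumes "bibd V1 \<B>1 v k lam1" "admits_zero_ulse V1 \<B>1 k l1"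
    and "bibd V2 \<B>2 v k lam2" "admits_zero_ulse V2 \<B>2 k l2"
  shows "l1 = l2"
proof -
  \<comment> \<open>Both sides equal \<open>k * (v - 1)\<close>, which involves neither \<lambda>
    nor the blocks. Then \<open>v - k > 0\<close> cancels and squaring is injective on
    naturals.\<close>
  have "(l1 - 1)\<^sup>2 * (v - k) = (l2 - 1)\<^sup>2 * (v - k)"
    using zero_ulse_equation(1)[OF assms(1,2)] zero_ulse_equation(1)[OF assms(3,4)] by simp
  moreover have "k < v" using assms(1) by (simp add: bibd_def)
  ultimately have "l1 - 1 = l2 - 1" by simp
  then show ?thesis
    using zero_ulse_equation(2)[OF assms(1,2)] zero_ulse_equation(2)[OF assms(3,4)] by simp
qed

theorem theorem3p15:
  "(\<forall>(V :: 'a set) \<B> v k lam. bibd V \<B> v k lam \<longrightarrow>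
      (\<exists>\<^sub>\<le>\<^sub>1 l. 0 < l \<and> l < v \<and> admits_zero_ulse V \<B> k l)) \<and>
   (\<forall>(V1 :: 'b set) \<B>1 (V2 :: 'c set) \<B>2 v k lam1 lam2 l1 l2.
      bibd V1 \<B>1 v k lam1 \<longrightarrow> l1 < v \<longrightarrow> admits_zero_ulse V1 \<B>1 k l1 \<longrightarrow>
      bibd V2 \<B>2 v k lam2 \<longrightarrow> l2 < v \<longrightarrow> admits_zero_ulse V2 \<B>2 k l2 \<longrightarrow>
      l1 = l2)"
  \<comment> \<open>The first part is the case in which the two designs coincide.\<close>
  unfolding Uniq_def by (intro conjI allI impI; (elim conjE)?; rule zero_ulse_colours_unique; assumption)

end
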